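(* Let $(\alpha_1,\dots,\alpha_m)\in[0,1]^m$ with $\sum_{k=1}^m\alpha_k=1$, let $x_1,\dots,x_m\in\mathbb{R}^d$, and define $Af:=\sum_{k=1}^m\alpha_kf(\cdot-x_k)$ for functions $f:\mathbb{R}^d\to\mathbb{R}$. Let $c\in(0,1)$ and let $g,h:\mathbb{R}^d\to\mathbb{R}$ be measurable with $Ag\ge g$, $Ah=h$ and $0\vee g\le h$. Define $\mathcal{D}f:=(c\cdot Af)\vee g$ for nonnegative measurable $f$, and put $q_n:=\mathcal{D}^n(g\vee0)$ for $n\in\mathbb{N}_0$. Then for all $n\in\mathbb{N}$, $$\left\|q_{n+1}-q_n\right\|_{C^0(\mathbb{R}^d,\mathbb{R})}\le c\cdot\left\|q_n-q_{n-1}\right\|_{C^0(\mathbb{R}^d,\mathbb{R})}.$$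
   Context: $\|f\|_{C^0(\mathbb{R}^d,\mathbb{R})}=\sup_{x\in\mathbb{R}^d}|f(x)|\in[0,+\infty]$ is the supremum norm, allowed to take the value $+\infty$. $\vee$ is the pointwise maximum; $\mathcal{D}^n$ is the $n$-fold composition of $\mathcal{D}$. *)

theory Defs
  imports "HOL-Analysis.Analysis"
begin

text \<open>Supremum norm with values in the extended reals; it is \<open>\<infinity>\<close> when \<open>f\<close> is unbounded.\<close>

definition sup_norm :: "(real ^ 'd \<Rightarrow> real) \<Rightarrow> ereal" where
  "sup_norm f = (SUP x. ereal \<bar>f x\<bar>)"

definition avg_op ::
    "nat \<Rightarrow> (nat \<Rightarrow> real) \<Rightarrow> (nat \<Rightarrow> real ^ 'd) \<Rightarrow> (real ^ 'd \<Rightarrow> real) \<Rightarrow> real ^ 'd \<Rightarrow> real" where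
  "avg_op m \<alpha> x f = (\<lambda>y. \<Sum>k=1..m. \<alpha> k * f (y - x k))"

text \<open>
  The operator \<open>f \<mapsto> (c \<cdot> A f) \<or> g\<close> with \<open>A = avg_op m \<alpha> x\<close>. It is meant for nonnegative
  measurable \<open>f\<close>; when \<open>\<alpha>\<close> and \<open>c\<close> are nonnegative and \<open>g\<close> is measurable, it maps such functions
  to such functions, so its iterates from \<open>g \<or> 0\<close> never leave this domain.
\<close>

definition disc_op ::
    "nat \<Rightarrow> (nat \<Rightarrow> real) \<Rightarrow> (nat \<Rightarrow> real ^ 'd) \<Rightarrow> real \<Rightarrow> (real ^ 'd \<Rightarrow> real)
      \<Rightarrow> (real ^ 'd \<Rightarrow> real) \<Rightarrow> real ^ 'd \<Rightarrow> real" where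
  "disc_op m \<alpha> x c g f = (\<lambda>y. max (c * avg_op m \<alpha> x f y) (g y))"

definition q_iter ::
    "nat \<Rightarrow> (nat \<Rightarrow> real) \<Rightarrow> (nat \<Rightarrow> real ^ 'd) \<Rightarrow> real \<Rightarrow> (real ^ 'd \<Rightarrow> real)
      \<Rightarrow> nat \<Rightarrow> real ^ 'd \<Rightarrow> real" where
  "q_iter m \<alpha> x c g n = (disc_op m \<alpha> x c g ^^ n) (\<lambda>y. max (g y) 0)"

end

theory Submission
  imports Defs
begin

text \<open>
  The map \<open>f \<mapsto> (c \<cdot> A f) \<or> g\<close> is \<open>c\<close>-Lipschitz for the supremum norm: averaging translates
  with weights of total mass one does not increase distances, multiplication by \<open>c\<close> scales them,
  and \<open>t \<mapsto> t \<or> g y\<close> is 1-Lipschitz for each \<open>y\<close>. Two consecutive iterates are the images of the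
  preceding two under this map (\<open>sup_norm_disc_op_contraction\<close>), which gives the theorem.
  Two functions may be at infinite distance, so the estimates are first made pointwise, against
  a real bound \<open>r\<close>; in the remaining case the right-hand side is infinite because \<open>c > 0\<close>.
\<close>

lemma avg_op_dist_le:
  assumes "\<And>k. k \<in> {1..m} \<Longrightarrow> 0 \<le> \<alpha> k" and "(\<Sum>k=1..m. \<alpha> k) = 1"
    and "\<And>z. \<bar>f z - f' z\<bar> \<le> r"
  shows "\<bar>avg_op m \<alpha> x f y - avg_op m \<alpha> x f' y\<bar> \<le> r"
proof -
  have "avg_op m \<alpha> x f y - avg_op m \<alpha> x f' y = (\<Sum>k=1..m. \<alpha> k * (f (y - x k) - f' (y - x k)))"
    by (simp add: avg_op_def sum_subtractf right_diff_distrib)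
  also have "\<bar>\<dots>\<bar> \<le> (\<Sum>k=1..m. \<bar>\<alpha> k * (f (y - x k) - f' (y - x k))\<bar>)"
    by (rule sum_abs)
  also have "\<dots> \<le> (\<Sum>k=1..m. \<alpha> k * r)"
    using assms(1,3) by (intro sum_mono) (simp add: abs_mult mult_left_mono)
  also have "\<dots> = r"
    using assms(2) by (simp flip: sum_distrib_right)
  finally show ?thesis .
qed

lemma disc_op_dist_le:
  assumes "\<And>k. k \<in> {1..m} \<Longrightarrow> 0 \<le> \<alpha> k" and "(\<Sum>k=1..m. \<alpha> k) = 1" and "0 \<le> c"
    and "\<And>z. \<bar>f z - f' z\<bar> \<le> r"
  shows "\<bar>disc_op m \<alpha> x c g f y - disc_op m \<alpha> x c g f' y\<bar> \<le> c * r"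
proof -
  have "\<bar>disc_op m \<alpha> x c g f y - disc_op m \<alpha> x c g f' y\<bar>
      \<le> \<bar>c * avg_op m \<alpha> x f y - c * avg_op m \<alpha> x f' y\<bar>"
    unfolding disc_op_def by linarith
  also have "\<dots> = c * \<bar>avg_op m \<alpha> x f y - avg_op m \<alpha> x f' y\<bar>"
    using assms(3) by (simp add: abs_mult flip: right_diff_distrib)
  also have "\<dots> \<le> c * r"
    by (intro mult_left_mono avg_op_dist_le assms)
  finally show ?thesis .
qed

lemma sup_norm_disc_op_contraction:
  assumes "\<And>k. k \<in> {1..m} \<Longrightarrow> 0 \<le> \<alpha> k" and "(\<Sum>k=1..m. \<alpha> k) = 1" and "0 < c"
  shows "sup_norm (\<lambda>y. disc_op m \<alpha> x c g f y - disc_op m \<alpha> x c g f' y)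
    \<le> ereal c * sup_norm (\<lambda>y. f y - f' y)"
proof -
  have upper: "ereal \<bar>f z - f' z\<bar> \<le> sup_norm (\<lambda>y. f y - f' y)" for z
    unfolding sup_norm_def by (rule SUP_upper) simp
  show ?thesis
  proof (cases "sup_norm (\<lambda>y. f y - f' y)")
    case (real r)
    then have "\<bar>f z - f' z\<bar> \<le> r" for z
      using upper[of z] by simp
    then have "\<bar>disc_op m \<alpha> x c g f y - disc_op m \<alpha> x c g f' y\<bar> \<le> c * r" for y
      using assms by (intro disc_op_dist_le) auto
    then show ?thesis
      unfolding real by (auto simp: sup_norm_def intro: SUP_least)
  next
    case PInf
    then show ?thesis using assms(3) by simp
  next
    case MInf
    then show ?thesis using upper by simp
  qed
qed

theorem theorem6p2:
  fixes m :: nat and \<alpha> :: "nat \<Rightarrow> real" and x :: "nat \<Rightarrow> real ^ 'd"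
    and c :: real and g h :: "real ^ 'd \<Rightarrow> real"
  assumes "\<And>k. k \<in> {1..m} \<Longrightarrow> \<alpha> k \<in> {0..1}"
    and "(\<Sum>k=1..m. \<alpha> k) = 1"
    and "c \<in> {0<..<1}"
    and "g \<in> borel_measurable borel" and "h \<in> borel_measurable borel"
    and "\<And>y. avg_op m \<alpha> x g y \<ge> g y"
    and "avg_op m \<alpha> x h = h"
    and "\<And>y. max 0 (g y) \<le> h y"
  shows "\<forall>n\<ge>1. sup_norm (\<lambda>y. q_iter m \<alpha> x c g (n + 1) y - q_iter m \<alpha> x c g n y)
    \<le> ereal c * sup_norm (\<lambda>y. q_iter m \<alpha> x c g n y - q_iter m \<alpha> x c g (n - 1) y)"
proof (intro allI impI)
  fix n :: nat
  assume "1 \<le> n"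
  then obtain k where "n = Suc k"
    by (cases n) auto
  then show "sup_norm (\<lambda>y. q_iter m \<alpha> x c g (n + 1) y - q_iter m \<alpha> x c g n y)
    \<le> ereal c * sup_norm (\<lambda>y. q_iter m \<alpha> x c g n y - q_iter m \<alpha> x c g (n - 1) y)"
    using sup_norm_disc_op_contraction[of m \<alpha> c x g "q_iter m \<alpha> x c g (Suc k)" "q_iter m \<alpha> x c g k"]
      assms(1-3)
    by (simp add: q_iter_def)
qed

end
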